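(* Let $m,k\in\mathbb{N}$ with $k<m$, let $0<\gamma<1$ and $\delta>0$. Let $\mathcal{V}\subset\mathbb{R}^m$ be a linear subspace satisfying the subspace property $$\|\mathbf{v}_{\mathcal{T}}\|_1\le\gamma\|\mathbf{v}_{\mathcal{T}^c}\|_1\quad\text{for all }\mathbf{v}\in\mathcal{V}\text{ and all }\mathcal{T}\subset\{1,\dots,m\}\text{ with }|\mathcal{T}|\le k,$$ and let $\mathcal{X}\subset\mathbb{R}^m$ be a convex set such that $\|\mathbf{x}\|_1\le\delta$ for all $\mathbf{x}\in\mathcal{X}$. Let $\mathbf{y}\in\mathbb{R}^m$ and let $\hat{\mathbf{e}}$ be an optimal solution of the problem $$\text{minimize over }\mathbf{e}\in\mathbb{R}^m:\ \|\mathbf{e}\|_1\quad\text{subject to}\quad \mathbf{y}-\mathbf{e}\in\mathcal{V}\cap\mathcal{X}.$$ Then for every feasible vector $\mathbf{e}\in\mathbb{R}^m$ of this problem, $$\|\hat{\mathbf{e}}-\mathbf{e}\|_1\le 2\,\mathrm{sat}_\delta\!\left(\frac{1+\gamma}{1-\gamma}\,\|\mathbf{e}-\mathbf{e}[k]\|_1\right),$$ where $\mathbf{e}[k]$ is a best $k$-term approximation of $\mathbf{e}$.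
   Context: For $\mathbf{v}\in\mathbb{R}^m$ and $\mathcal{T}\subset\{1,\dots,m\}$, $\mathbf{v}_{\mathcal{T}}$ denotes the subvector of entries indexed by $\mathcal{T}$, and $\mathcal{T}^c$ is the complement of $\mathcal{T}$ in $\{1,\dots,m\}$. $\|\cdot\|_0$ counts nonzero entries. A best $k$-term approximation of $\mathbf{e}\in\mathbb{R}^m$ is a vector $\mathbf{e}[k]\in\operatorname{arg\,min}_{\|\mathbf{f}\|_0\le k}\|\mathbf{e}-\mathbf{f}\|_1$. For $\delta>0$, the saturation function $\mathrm{sat}_\delta:\mathbb{R}\to[-\delta,\delta]$ is $\mathrm{sat}_\delta(x)=-\delta$ if $x<-\delta$, $\mathrm{sat}_\delta(x)=x$ if $|x|\le\delta$, and $\mathrm{sat}_\delta(x)=\delta$ if $x>\delta$. *)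

theory Defs
  imports "HOL-Analysis.Analysis"
begin

text \<open>
  The l1 norm of the subvector of \<open>v\<close> whose entries are indexed by \<open>T\<close>; subvectors are not
  given a type of their own.
\<close>

definition l1_norm_on :: "'m::finite set \<Rightarrow> real ^ 'm \<Rightarrow> real" where
  "l1_norm_on T v = (\<Sum>i\<in>T. \<bar>v $ i\<bar>)"

abbreviation l1_norm :: "real ^ 'm::finite \<Rightarrow> real" where
  "l1_norm \<equiv> l1_norm_on UNIV"

definition l0_norm :: "real ^ 'm::finite \<Rightarrow> nat" where
  "l0_norm v = card {i. v $ i \<noteq> 0}"

text \<open>Best k-term approximations need not be unique, hence a predicate.\<close>

definition best_term_approx :: "nat \<Rightarrow> real ^ 'm::finite \<Rightarrow> real ^ 'm \<Rightarrow> bool" where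
  "best_term_approx k e ek \<longleftrightarrow> is_arg_min (\<lambda>f. l1_norm (e - f)) (\<lambda>f. l0_norm f \<le> k) ek"

definition subspace_property :: "nat \<Rightarrow> real \<Rightarrow> (real ^ 'm::finite) set \<Rightarrow> bool" where
  "subspace_property k \<gamma> V \<longleftrightarrow>
     (\<forall>v\<in>V. \<forall>T. card T \<le> k \<longrightarrow> l1_norm_on T v \<le> \<gamma> * l1_norm_on (- T) v)"

definition sat :: "real \<Rightarrow> real \<Rightarrow> real" where
  "sat \<delta> x = (if x < - \<delta> then - \<delta> else if \<bar>x\<bar> \<le> \<delta> then x else \<delta>)"

definition feasible ::
    "(real ^ 'm::finite) set \<Rightarrow> (real ^ 'm) set \<Rightarrow> real ^ 'm \<Rightarrow> real ^ 'm \<Rightarrow> bool" where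
  "feasible V X y e \<longleftrightarrow> y - e \<in> V \<inter> X"

end

theory Submission
  imports Defs
begin

text \<open>
  Let \<open>v\<close> be the difference between the minimiser and a feasible \<open>e\<close>. It is also the
  difference of the two residuals, which gives it two properties: it lies in \<open>V\<close>, because \<open>V\<close> is a
  subspace, and its l1 norm is at most \<open>2\<delta>\<close>, because both residuals lie in \<open>X\<close>. The second
  property is the saturated branch of the bound.

  The unsaturated branch is the null space argument of sparse recovery (lemma
  \<open>l1_norm_le_of_subspace_property\<close>). Let \<open>T\<close> be the support of the \<open>k\<close>-term approximation.
  Passing from \<open>e\<close> to \<open>e + v\<close> can lower the l1 norm by at most the mass of \<open>v\<close> on \<open>T\<close>, whereas
  off \<open>T\<close>, where \<open>e\<close> is small, the mass of \<open>v\<close> mostly adds to the norm. Minimality forbids an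
  increase, so the mass of \<open>v\<close> off \<open>T\<close> is at most its mass on \<open>T\<close> plus twice the tail of \<open>e\<close>.
  The subspace property bounds the mass on \<open>T\<close> by \<open>\<gamma>\<close> times the mass off \<open>T\<close>; since
  \<open>\<gamma> < 1\<close> it can be absorbed, and both masses are controlled by the tail.

  The tail of \<open>e\<close> off the support of any approximation \<open>f\<close> is at most the l1 norm of \<open>e - f\<close>.
\<close>

lemma l1_norm_on_nonneg: "0 \<le> l1_norm_on T v"
  unfolding l1_norm_on_def by (simp add: sum_nonneg)

lemma l1_norm_on_add_le: "l1_norm_on T (u + v) \<le> l1_norm_on T u + l1_norm_on T v"
  unfolding l1_norm_on_def by (simp flip: sum.distrib add: sum_mono abs_triangle_ineq)

lemma l1_norm_on_minus: "l1_norm_on T (- v) = l1_norm_on T v"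
  unfolding l1_norm_on_def by simp

lemma l1_norm_split: "l1_norm v = l1_norm_on T v + l1_norm_on (- T) v"
  unfolding l1_norm_on_def Compl_eq_Diff_UNIV
  by (simp add: sum.subset_diff[OF subset_UNIV finite_class.finite_UNIV, of _ T] add.commute)

lemma l1_norm_on_compl_support_le: "l1_norm_on (- {i. f $ i \<noteq> 0}) e \<le> l1_norm (e - f)"
proof -
  have "l1_norm_on (- {i. f $ i \<noteq> 0}) e = l1_norm_on (- {i. f $ i \<noteq> 0}) (e - f)"
    unfolding l1_norm_on_def by (rule sum.cong) auto
  then show ?thesis
    using l1_norm_split[of "e - f" "{i. f $ i \<noteq> 0}"] l1_norm_on_nonneg[of "{i. f $ i \<noteq> 0}" "e - f"]
    by linarith
qed

text \<open>
  The triangle inequality is applied in opposite directions on \<open>T\<close> and on its complement: on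
  \<open>T\<close> the vector \<open>v\<close> counts as the perturbation, off \<open>T\<close> the vector \<open>e\<close> does. The sum of the
  two estimates bounds the mass of \<open>v\<close> off \<open>T\<close> in terms of its mass on \<open>T\<close>, and the subspace
  property bounds the latter back by \<open>\<gamma>\<close> times the former.
\<close>

lemma l1_norm_le_of_subspace_property:
  assumes "subspace_property k \<gamma> V" "0 < \<gamma>" "\<gamma> < 1" "v \<in> V" "card T \<le> k"
    and le: "l1_norm (e + v) \<le> l1_norm e"
  shows "l1_norm v \<le> 2 * ((1 + \<gamma>) / (1 - \<gamma>) * l1_norm_on (- T) e)"
proof -
  have T: "l1_norm_on T v \<le> \<gamma> * l1_norm_on (- T) v"
    using assms unfolding subspace_property_def by blast
  have on_T: "l1_norm_on T e \<le> l1_norm_on T (e + v) + l1_norm_on T v"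
    using l1_norm_on_add_le[of T "e + v" "- v"] by (simp add: l1_norm_on_minus)
  have off_T: "l1_norm_on (- T) v \<le> l1_norm_on (- T) (e + v) + l1_norm_on (- T) e"
    using l1_norm_on_add_le[of "- T" "e + v" "- e"] by (simp add: l1_norm_on_minus)
  have "l1_norm_on (- T) v \<le> l1_norm_on T v + 2 * l1_norm_on (- T) e"
    using on_T off_T le l1_norm_split[of e T] l1_norm_split[of "e + v" T] by linarith
  with T have "(1 - \<gamma>) * l1_norm_on (- T) v \<le> 2 * l1_norm_on (- T) e"
    by (simp add: algebra_simps)
  then have tail: "l1_norm_on (- T) v \<le> 2 * l1_norm_on (- T) e / (1 - \<gamma>)"
    using \<open>\<gamma> < 1\<close> by (simp add: pos_le_divide_eq mult.commute)
  have "l1_norm v \<le> (1 + \<gamma>) * l1_norm_on (- T) v"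
    using T l1_norm_split[of v T] by (simp add: algebra_simps)
  also have "\<dots> \<le> (1 + \<gamma>) * (2 * l1_norm_on (- T) e / (1 - \<gamma>))"
    using tail \<open>0 < \<gamma>\<close> by (intro mult_left_mono) auto
  finally show ?thesis by (simp add: mult_ac)
qed

lemma sat_eq_min: "0 \<le> \<delta> \<Longrightarrow> 0 \<le> x \<Longrightarrow> sat \<delta> x = min \<delta> x"
  unfolding sat_def by auto

theorem theorem6:
  fixes k :: nat and \<gamma> \<delta> :: real
    and V X :: "(real ^ 'm::finite) set"
    and y e_hat :: "real ^ 'm"
  assumes "k < CARD('m)"
    and "0 < \<gamma>" and "\<gamma> < 1" and "\<delta> > 0"
    and "subspace V" and "subspace_property k \<gamma> V"
    and "convex X" and "\<forall>x\<in>X. l1_norm x \<le> \<delta>"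
    and "is_arg_min l1_norm (feasible V X y) e_hat"
  shows "\<forall>e. feasible V X y e \<longrightarrow>
           (\<forall>ek. best_term_approx k e ek \<longrightarrow>
              l1_norm (e_hat - e) \<le> 2 * sat \<delta> ((1 + \<gamma>) / (1 - \<gamma>) * l1_norm (e - ek)))"
proof (intro allI impI)
  fix e ek
  assume e: "feasible V X y e" and ek: "best_term_approx k e ek"
  define T where "T = {i. ek $ i \<noteq> 0}"
  define v where "v = e_hat - e"
  define B where "B = (1 + \<gamma>) / (1 - \<gamma>) * l1_norm (e - ek)"
  have e_hat: "feasible V X y e_hat" and le: "l1_norm (e + v) \<le> l1_norm e"
    using assms(9) e unfolding is_arg_min_def v_def by (auto simp: not_less)
  have v_residuals: "v = (y - e) + - (y - e_hat)"
    by (simp add: v_def)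
  have "v \<in> V"
    using e e_hat subspace_diff[OF \<open>subspace V\<close>, of "y - e" "y - e_hat"]
    unfolding feasible_def v_residuals by simp
  moreover have "card T \<le> k"
    using ek unfolding best_term_approx_def is_arg_min_def l0_norm_def T_def by blast
  ultimately have "l1_norm v \<le> 2 * ((1 + \<gamma>) / (1 - \<gamma>) * l1_norm_on (- T) e)"
    using l1_norm_le_of_subspace_property assms(2,3,6) le by blast
  also have "\<dots> \<le> 2 * B"
    using l1_norm_on_compl_support_le[of ek e] assms(2,3)
    unfolding B_def T_def by (intro mult_left_mono) auto
  finally have unsaturated: "l1_norm v \<le> 2 * B" .
  have "l1_norm (y - e) \<le> \<delta>" "l1_norm (y - e_hat) \<le> \<delta>"
    using e e_hat assms(8) unfolding feasible_def by auto
  then have saturated: "l1_norm v \<le> 2 * \<delta>"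
    using l1_norm_on_add_le[of UNIV "y - e" "- (y - e_hat)"]
      l1_norm_on_minus[of UNIV "y - e_hat"] unfolding v_residuals by linarith
  have "0 \<le> B"
    using assms(2,3) l1_norm_on_nonneg[of UNIV "e - ek"] unfolding B_def by simp
  then have "l1_norm v \<le> 2 * sat \<delta> B"
    using unsaturated saturated \<open>\<delta> > 0\<close> by (simp add: sat_eq_min min_def)
  then show "l1_norm (e_hat - e) \<le> 2 * sat \<delta> ((1 + \<gamma>) / (1 - \<gamma>) * l1_norm (e - ek))"
    unfolding v_def B_def .
qed

end
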